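(* Let $\lambda_{d,k}$, $k\in\mathbb N$, be the coefficients of $\lambda(z)=\frac{\alpha(z)}{\beta(z)}(1-z^s)^{-d}=\sum_{k=0}^\infty\lambda_{d,k}z^k$, $|z|<1$, with $d<0.5$, and let $f(z)=\frac{\alpha(z)}{\beta(z)}=\sum_{k=0}^\infty f_kz^k$. Then, for each $r\in\{0,\dots,s-1\}$, as $k\to\infty$, $$\lambda_{d,sk+r}=\frac{1}{\Gamma(d)k^{1-d}}\frac{\alpha(1)}{\beta(1)}-\frac{1}{\Gamma(d)k^{1-d}}\sum_{j=0}^{sk+r}f_j\,\mathbb I_{\mathbb R\setminus\mathbb N}\!\left(\frac{|j-r|}{s}\right)+O(k^{d-2})$$ $$=O(k^{d-1})+O(k^{d-1})\,\mathbb I_{\mathbb N\setminus\{0,1\}}(s)+O(k^{d-2}).$$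
   Context: $\mathbb N=\{0,1,2,\dots\}$. Here $d\in\mathbb R$, $s\ge 1$ is an integer, and $\alpha(z)=\sum_{i=0}^p(-\alpha_i)z^i$ and $\beta(z)=\sum_{j=0}^q(-\beta_j)z^j$ are real polynomials of orders $p,q\ge 0$ with $\alpha_0=\beta_0=-1$, with no common roots, and with $\beta(z)\ne0$ for all $|z|\le1$. $\mathbb I_A(x)=1$ if $x\in A$ and $0$ otherwise. $1/\Gamma(d)$ is read as $0$ when $d$ is a nonpositive integer. *)

theory Defs
  imports "HOL-Analysis.Analysis" "HOL-Library.Landau_Symbols"
    "HOL-Computational_Algebra.Polynomial"
begin

(* Sign convention of the lag polynomials: a 0 = -1 makes the constant coefficient +1.
   The leading coefficient may vanish, so n bounds the degree. *)
definition lag_poly :: "(nat \<Rightarrow> real) \<Rightarrow> nat \<Rightarrow> real poly" where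
  "lag_poly a n = (\<Sum>i\<le>n. monom (- a i) i)"

definition cpoly :: "real poly \<Rightarrow> complex \<Rightarrow> complex" where
  "cpoly P z = poly (map_poly complex_of_real P) z"

end

theory Submission
  imports Defs "HOL-Real_Asymp.Real_Asymp" "HOL-Complex_Analysis.Cauchy_Integral_Formula"
begin

text \<open>
  Write \<open>(1 - w)\<^sup>-\<^sup>d = \<Sum>i. c\<^sub>i w\<^sup>i\<close> with \<open>c\<^sub>i = pochhammer d i / i!\<close>. Substituting \<open>w = z\<^sup>s\<close> and
  multiplying by \<open>\<Sum>j. f\<^sub>j z\<^sup>j\<close> shows that only indices \<open>j\<close> congruent to \<open>r\<close> modulo \<open>s\<close>
  contribute to the coefficient of index \<open>s k + r\<close>, which is therefore
  \<open>\<Sum>m\<le>k. f\<^bsub>s m + r\<^esub> c\<^bsub>k - m\<^esub>\<close> (\<open>seasonal_series_coeff\<close>, \<open>sum_residue_class\<close>).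

  Since \<open>\<beta>\<close> has no root in the closed unit disc, \<open>\<alpha>/\<beta>\<close> is holomorphic on a strictly larger
  disc, so \<open>f\<close> decays geometrically and sums to \<open>\<alpha>(1)/\<beta>(1)\<close>
  (\<open>rational_power_series_decay\<close>). Under this decay the convolution only sees \<open>c\<^sub>i\<close> for
  \<open>i\<close> close to \<open>k\<close>, and there \<open>c\<^sub>i\<close> may be replaced by \<open>k\<^bsup>d-1\<^esup> / \<Gamma>(d)\<close> at a cost of order
  \<open>k\<^bsup>d-2\<^esup>\<close> (\<open>convolution_neg_binomial_asymp\<close>). What is left is \<open>k\<^bsup>d-1\<^esup> / \<Gamma>(d)\<close> times the sum of
  the \<open>f\<^sub>j\<close> over the residue class of \<open>r\<close> up to \<open>s k + r\<close>. The formula of the theorem has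
  instead the full sum \<open>\<alpha>(1)/\<beta>(1)\<close> minus the sum over the other residue classes up to
  \<open>s k + r\<close>; the two differ by the tail of \<open>\<Sum>j. f\<^sub>j\<close>, which is \<open>O(1/k)\<close>
  (\<open>suminf_tail_bigo\<close>).

  All estimates on \<open>c\<^sub>i\<close> come from the convergence of \<open>c\<^sub>k k\<^bsup>1-d\<^esup>\<close> to \<open>1/\<Gamma>(d)\<close>, which also
  covers the nonpositive integers \<open>d\<close>: there the limit is \<open>0\<close> and the \<open>c\<^sub>k\<close> vanish eventually.
\<close>

section \<open>Asymptotics of the negative binomial coefficients\<close>

text \<open>The coefficient of \<open>w\<^sup>k\<close> in \<open>(1 - w)\<^sup>-\<^sup>d\<close>.\<close>

definition neg_binomial_coeff :: "real \<Rightarrow> nat \<Rightarrow> real" where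
  "neg_binomial_coeff d k = pochhammer d k / fact k"

text \<open>The increments beyond \<open>k\<close> are dominated by the telescoping series
  \<open>1/n\<^sup>2 \<le> 1/(n - 1) - 1/n\<close>, whose sum from \<open>k\<close> on is \<open>1/(k - 1)\<close>.\<close>

lemma LIMSEQ_rate_inverse:
  fixes x :: "nat \<Rightarrow> real"
  assumes lim: "x \<longlonglongrightarrow> L"
    and step: "(\<lambda>k. x (Suc k) - x k) \<in> O(\<lambda>k. 1 / real k ^ 2)"
  shows "(\<lambda>k. x k - L) \<in> O(\<lambda>k. 1 / real k)"
proof -
  obtain C where C: "C > 0"
    and "eventually (\<lambda>k. norm (x (Suc k) - x k) \<le> C * norm (1 / real k ^ 2)) sequentially"
    using landau_o.bigE[OF step] by blast
  then obtain N where N: "\<And>k. k \<ge> N \<Longrightarrow> \<bar>x (Suc k) - x k\<bar> \<le> C * (1 / real k ^ 2)"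
    by (auto simp: eventually_sequentially)
  have tele: "\<bar>x (k + m) - x k\<bar> \<le> C * (1 / (real k - 1) - 1 / (real (k + m) - 1))"
    if k: "k \<ge> N" "k \<ge> 2" for k m
  proof (induction m)
    case (Suc m)
    have gt: "real (k + m) > 1" using k by simp
    have "\<bar>x (Suc (k + m)) - x (k + m)\<bar> \<le> C * (1 / real (k + m) ^ 2)"
      using N[of "k + m"] k by simp
    also have "1 / real (k + m) ^ 2 \<le> 1 / (real (k + m) - 1) - 1 / real (k + m)"
      using gt by (simp add: divide_simps power2_eq_square)
    finally have "\<bar>x (Suc (k + m)) - x (k + m)\<bar>
        \<le> C * (1 / (real (k + m) - 1) - 1 / real (k + m))"
      using C by simp
    then show ?case using Suc.IH by (simp add: algebra_simps)
  qed simp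
  have "\<bar>x k - L\<bar> \<le> 2 * C * (1 / real k)" if k: "k \<ge> max N 2" for k
  proof -
    have "(\<lambda>m. \<bar>x (k + m) - x k\<bar>) \<longlonglongrightarrow> \<bar>L - x k\<bar>"
      using LIMSEQ_ignore_initial_segment[OF lim, of k]
      by (intro tendsto_intros) (simp add: add.commute)
    moreover have "\<bar>x (k + m) - x k\<bar> \<le> C * (1 / (real k - 1))" for m
    proof -
      have "C * (1 / (real k - 1) - 1 / (real (k + m) - 1)) \<le> C * (1 / (real k - 1))"
        using k C by (intro mult_left_mono) auto
      then show ?thesis using tele[of k m] k by simp
    qed
    ultimately have "\<bar>L - x k\<bar> \<le> C * (1 / (real k - 1))"
      by (intro LIMSEQ_le_const2) auto
    also have "\<dots> \<le> C * (2 * (1 / real k))"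
      using k C by (intro mult_left_mono) (auto simp: field_simps)
    finally show ?thesis by (simp add: abs_minus_commute mult_ac)
  qed
  then show ?thesis
    by (intro landau_o.bigI[of "2 * C"])
       (use C in \<open>auto simp: eventually_sequentially intro!: exI[of _ "max N 2"]\<close>)
qed

text \<open>Euler's product for \<open>1/\<Gamma>\<close> has one more factor \<open>d + k\<close> in the Pochhammer symbol, which the
  correction \<open>k/(k + d)\<close> removes.\<close>

lemma neg_binomial_coeff_scaled_LIMSEQ:
  "(\<lambda>k. neg_binomial_coeff d k * real k powr (1 - d)) \<longlonglongrightarrow> rGamma d"
proof -
  have "(\<lambda>k. rGamma_series d k * (real k / (real k + d))) \<longlonglongrightarrow> rGamma d * 1"
    by (intro tendsto_mult rGamma_series_LIMSEQ) real_asymp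
  moreover have "eventually (\<lambda>k. real k + d \<noteq> 0) sequentially"
    using eventually_gt_at_top[of "nat \<lceil>- d\<rceil>"] by eventually_elim linarith
  then have "eventually (\<lambda>k. rGamma_series d k * (real k / (real k + d))
      = neg_binomial_coeff d k * real k powr (1 - d)) sequentially"
    using eventually_gt_at_top[of 0]
  proof eventually_elim
    case (elim k)
    have "exp (d * ln (real k)) = real k powr d"
      using elim by (simp add: powr_def)
    then have "rGamma_series d k = pochhammer d k * (d + real k) / (fact k * real k powr d)"
      by (simp add: rGamma_series_def pochhammer_Suc)
    moreover have "real k powr (1 - d) = real k / real k powr d"
      using elim by (simp add: powr_diff)
    ultimately show ?case
      using elim by (simp add: neg_binomial_coeff_def add.commute)
  qed
  ultimately show ?thesis by (simp add: filterlim_cong)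
qed

text \<open>Let \<open>x\<^sub>k = c\<^sub>k k\<^bsup>1-d\<^esup>\<close>. The powers are chosen so that the first-order terms of the ratio
  \<open>x\<^bsub>k+1\<^esub> / x\<^sub>k\<close> cancel, leaving \<open>1 + O(1/k\<^sup>2)\<close>. As \<open>x\<close> is bounded, its increments are
  \<open>O(1/k\<^sup>2)\<close>, and so \<open>x\<close> approaches its limit \<open>1/\<Gamma>(d)\<close> at rate \<open>1/k\<close>.\<close>

lemma neg_binomial_coeff_asymp:
  "(\<lambda>k. neg_binomial_coeff d k - rGamma d * real k powr (d - 1)) \<in> O(\<lambda>k. real k powr (d - 2))"
proof -
  define x where "x = (\<lambda>k. neg_binomial_coeff d k * real k powr (1 - d))"
  define q where "q = (\<lambda>k. (real k + d) / (real k + 1) * ((real k + 1) / real k) powr (1 - d) - 1)"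
  have lim: "x \<longlonglongrightarrow> rGamma d"
    unfolding x_def by (rule neg_binomial_coeff_scaled_LIMSEQ)
  have "x \<in> O(\<lambda>_. 1)"
    using lim by (intro bigoI_tendsto[where c = "rGamma d"]) auto
  moreover have "q \<in> O(\<lambda>k. 1 / real k ^ 2)"
    unfolding q_def by real_asymp
  ultimately have "(\<lambda>k. x k * q k) \<in> O(\<lambda>k. 1 * (1 / real k ^ 2))"
    by (rule landau_o.big.mult)
  moreover have "eventually (\<lambda>k. x (Suc k) - x k = x k * q k) sequentially"
    using eventually_gt_at_top[of 0]
  proof eventually_elim
    case (elim k)
    have "real (Suc k) powr (1 - d) = ((real k + 1) / real k) powr (1 - d) * real k powr (1 - d)"
      using elim by (simp add: powr_divide add.commute)
    moreover have "neg_binomial_coeff d (Suc k)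
        = neg_binomial_coeff d k * ((real k + d) / (real k + 1))"
      by (simp add: neg_binomial_coeff_def pochhammer_Suc field_simps)
    ultimately show ?case by (simp add: x_def q_def algebra_simps)
  qed
  ultimately have "(\<lambda>k. x (Suc k) - x k) \<in> O(\<lambda>k. 1 / real k ^ 2)"
    by (simp add: landau_o.big.in_cong)
  with lim have "(\<lambda>k. x k - rGamma d) \<in> O(\<lambda>k. 1 / real k)"
    by (rule LIMSEQ_rate_inverse)
  then have "(\<lambda>k. (x k - rGamma d) * real k powr (d - 1))
      \<in> O(\<lambda>k. 1 / real k * real k powr (d - 1))"
    by (intro landau_o.big.mult) auto
  also have "(\<lambda>k. 1 / real k * real k powr (d - 1)) \<in> O(\<lambda>k. real k powr (d - 2))"
    by real_asymp
  finally have scaled: "(\<lambda>k. (x k - rGamma d) * real k powr (d - 1)) \<in> O(\<lambda>k. real k powr (d - 2))" .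
  have "eventually (\<lambda>k. (x k - rGamma d) * real k powr (d - 1)
      = neg_binomial_coeff d k - rGamma d * real k powr (d - 1)) sequentially"
    using eventually_gt_at_top[of 0]
  proof eventually_elim
    case (elim k)
    have "real k powr (1 - d) * real k powr (d - 1) = 1"
      using elim by (simp flip: powr_add)
    then show ?case by (simp add: x_def left_diff_distrib mult.assoc)
  qed
  then have "(\<lambda>k. (x k - rGamma d) * real k powr (d - 1)) \<in> O(\<lambda>k. real k powr (d - 2))
    \<longleftrightarrow> ?thesis"
    by (rule landau_o.big.in_cong)
  with scaled show ?thesis by blast
qed

text \<open>With base \<open>k\<close> instead of \<open>Suc k\<close> the right-hand side would be \<open>0\<close> at \<open>k = 0\<close>, where the
  coefficient is \<open>1\<close>.\<close>

lemma neg_binomial_coeff_bound: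
  obtains C where "C > 0" "\<And>k. \<bar>neg_binomial_coeff d k\<bar> \<le> C * real (Suc k) powr (d - 1)"
proof -
  define y where "y = (\<lambda>k. neg_binomial_coeff d k / real (Suc k) powr (d - 1))"
  have "(\<lambda>k. neg_binomial_coeff d k * real k powr (1 - d)
      * (real k powr (d - 1) / real (Suc k) powr (d - 1))) \<longlonglongrightarrow> rGamma d * 1"
    by (intro tendsto_mult neg_binomial_coeff_scaled_LIMSEQ) real_asymp
  moreover have "eventually (\<lambda>k. neg_binomial_coeff d k * real k powr (1 - d)
      * (real k powr (d - 1) / real (Suc k) powr (d - 1)) = y k) sequentially"
    using eventually_gt_at_top[of 0]
  proof eventually_elim
    case (elim k)
    have "real k powr (1 - d) * real k powr (d - 1) = 1"
      using elim by (simp flip: powr_add)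
    then show ?case by (simp add: y_def mult.assoc)
  qed
  ultimately have "y \<longlonglongrightarrow> rGamma d" by (simp add: filterlim_cong)
  then have "Bseq y" by (intro convergent_imp_Bseq) (auto simp: convergent_def)
  then obtain C where C: "C > 0" "\<And>k. norm (y k) \<le> C" by (rule BseqE) auto
  show thesis
  proof (rule that[OF C(1)])
    fix k
    show "\<bar>neg_binomial_coeff d k\<bar> \<le> C * real (Suc k) powr (d - 1)"
      using C(2)[of k] by (simp add: y_def divide_le_eq)
  qed
qed

text \<open>Differencing multiplies the generating function \<open>(1 - w)\<^sup>-\<^sup>d\<close> by \<open>1 - w\<close>, that is, it lowers \<open>d\<close>
  by one.\<close>

lemma neg_binomial_coeff_diff:
  "neg_binomial_coeff d (Suc i) - neg_binomial_coeff d i = neg_binomial_coeff (d - 1) (Suc i)"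
proof -
  define F where "F = (fact i :: real)"
  have F: "F > 0" "fact (Suc i) = (real i + 1) * F" by (simp_all add: F_def)
  show ?thesis
    unfolding neg_binomial_coeff_def pochhammer_rec[of "d - 1"] pochhammer_Suc[of d] F(2)
      F_def[symmetric]
    using F(1) by (simp add: divide_simps) (simp add: algebra_simps)
qed

text \<open>A shift by \<open>m\<close> is a sum of \<open>m\<close> differences, each of which is a coefficient for the parameter
  \<open>d - 1\<close> and hence of order \<open>(i + 1)\<^bsup>d-2\<^esup>\<close>, the size at the smaller index \<open>i\<close> because \<open>d < 2\<close>.
  The inequality \<open>i + m + 1 \<le> (i + 1)(m + 1)\<close> transfers this to the larger index, at the price
  of a polynomial factor in \<open>m\<close> that a rapidly decaying weight absorbs.\<close>

lemma neg_binomial_coeff_shift: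
  assumes "d < 2"
  obtains C where "C > 0"
    "\<And>i m. \<bar>neg_binomial_coeff d i - neg_binomial_coeff d (i + m)\<bar>
      \<le> C * (real (Suc m) powr (3 - d) * real (Suc (i + m)) powr (d - 2))"
proof -
  obtain C where C: "C > 0" "\<And>k. \<bar>neg_binomial_coeff (d - 1) k\<bar> \<le> C * real (Suc k) powr (d - 2)"
    using neg_binomial_coeff_bound[of "d - 1"] by (auto simp: algebra_simps)
  have lin: "\<bar>neg_binomial_coeff d i - neg_binomial_coeff d (i + m)\<bar>
      \<le> real m * (C * real (Suc i) powr (d - 2))" for i m
  proof (induction m)
    case (Suc m)
    have "\<bar>neg_binomial_coeff d (i + m) - neg_binomial_coeff d (Suc (i + m))\<bar>
        \<le> C * real (Suc (Suc (i + m))) powr (d - 2)"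
      using C(2)[of "Suc (i + m)"] neg_binomial_coeff_diff[of d "i + m"] by simp
    also have "\<dots> \<le> C * real (Suc i) powr (d - 2)"
      using C(1) assms by (intro mult_left_mono powr_mono2') auto
    finally show ?case using Suc.IH by (simp add: algebra_simps)
  qed simp
  show thesis
  proof (rule that[OF C(1)])
    fix i m
    have "real (Suc (i + m)) powr (2 - d) \<le> (real (Suc i) * real (Suc m)) powr (2 - d)"
      using assms by (intro powr_mono2) (auto simp: algebra_simps)
    then have le: "real (Suc (i + m)) powr (2 - d)
        \<le> real (Suc i) powr (2 - d) * real (Suc m) powr (2 - d)"
      by (simp only: powr_mult)
    have swap: "1 / x \<le> y * (1 / p)" if "p \<le> x * y" "x > 0" "p > 0" for x y p :: real
      using that by (simp add: field_simps)
    have reciprocal: "x powr (d - 2) = 1 / x powr (2 - d)" for x :: real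
      using powr_minus_divide[of x "2 - d"] by simp
    have sub: "real (Suc i) powr (d - 2)
        \<le> real (Suc m) powr (2 - d) * real (Suc (i + m)) powr (d - 2)"
      unfolding reciprocal using le by (rule swap) simp_all
    have "real m * (C * real (Suc i) powr (d - 2))
        \<le> real (Suc m) * (C * (real (Suc m) powr (2 - d) * real (Suc (i + m)) powr (d - 2)))"
      using C(1) sub by (intro mult_mono mult_left_mono) auto
    also have "\<dots> = C * (real (Suc m) powr (3 - d) * real (Suc (i + m)) powr (d - 2))"
      using powr_add[of "real (Suc m)" 1 "2 - d"] by simp
    finally show "\<bar>neg_binomial_coeff d i - neg_binomial_coeff d (i + m)\<bar>
      \<le> C * (real (Suc m) powr (3 - d) * real (Suc (i + m)) powr (d - 2))"
      using lin[of i m] by linarith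
  qed
qed

section \<open>Convolution with a rapidly decaying sequence\<close>

text \<open>Each term is split at \<open>c\<^sub>k\<close>: the shift \<open>c\<^bsub>k-m\<^esub> - c\<^sub>k\<close> costs a power of \<open>m + 1\<close> that the
  summability of \<open>g\<close> pays for, and the error of \<open>c\<^sub>k\<close> itself does not depend on \<open>m\<close>. Both are
  \<open>O(k\<^bsup>d-2\<^esup>)\<close> after factoring out the weighted sum of \<open>g\<close>.\<close>

lemma convolution_neg_binomial_asymp:
  assumes "d < 2" and sm: "summable (\<lambda>m. \<bar>g m\<bar> * real (Suc m) powr (3 - d))"
  shows "(\<lambda>k. \<Sum>m\<le>k. g m * (neg_binomial_coeff d (k - m) - rGamma d * real k powr (d - 1)))
    \<in> O(\<lambda>k. real k powr (d - 2))"
proof -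
  obtain C where C: "C > 0"
    "\<And>i m. \<bar>neg_binomial_coeff d i - neg_binomial_coeff d (i + m)\<bar>
      \<le> C * (real (Suc m) powr (3 - d) * real (Suc (i + m)) powr (d - 2))"
    using neg_binomial_coeff_shift[OF assms(1)] by metis
  define w where "w = (\<lambda>m. \<bar>g m\<bar> * real (Suc m) powr (3 - d))"
  define e where "e = (\<lambda>k. neg_binomial_coeff d k - rGamma d * real k powr (d - 1))"
  have gw: "\<bar>g m\<bar> \<le> w m" for m
  proof -
    have "1 \<le> real (Suc m) powr (3 - d)" using assms(1) by (intro ge_one_powr_ge_zero) auto
    then show ?thesis unfolding w_def by (simp add: mult_le_cancel_left1)
  qed
  have partial: "(\<Sum>m\<le>k. w m) \<le> suminf w" for k
    using sm unfolding w_def by (intro sum_le_suminf) auto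
  define h where "h = (\<lambda>k. C * real (Suc k) powr (d - 2) + \<bar>e k\<bar>)"
  have bound: "\<bar>\<Sum>m\<le>k. g m * (neg_binomial_coeff d (k - m) - rGamma d * real k powr (d - 1))\<bar>
      \<le> suminf w * h k" for k
  proof -
    have "\<bar>\<Sum>m\<le>k. g m * (neg_binomial_coeff d (k - m) - rGamma d * real k powr (d - 1))\<bar>
        \<le> (\<Sum>m\<le>k. w m * h k)"
    proof (rule order.trans[OF sum_abs sum_mono])
      fix m assume "m \<in> {..k}"
      then have "\<bar>neg_binomial_coeff d (k - m) - neg_binomial_coeff d k\<bar>
          \<le> C * (real (Suc m) powr (3 - d) * real (Suc k) powr (d - 2))"
        using C(2)[of "k - m" m] by simp
      then have "\<bar>g m\<bar> * \<bar>neg_binomial_coeff d (k - m) - neg_binomial_coeff d k\<bar>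
          \<le> \<bar>g m\<bar> * (C * (real (Suc m) powr (3 - d) * real (Suc k) powr (d - 2)))"
        by (rule mult_left_mono) simp
      then have "\<bar>g m\<bar> * \<bar>neg_binomial_coeff d (k - m) - neg_binomial_coeff d k\<bar>
          \<le> w m * (C * real (Suc k) powr (d - 2))"
        by (simp add: w_def mult_ac)
      moreover have "\<bar>g m\<bar> * \<bar>e k\<bar> \<le> w m * \<bar>e k\<bar>"
        using gw by (rule mult_right_mono) simp
      moreover have "\<bar>g m * (neg_binomial_coeff d (k - m) - rGamma d * real k powr (d - 1))\<bar>
          \<le> \<bar>g m\<bar> * \<bar>neg_binomial_coeff d (k - m) - neg_binomial_coeff d k\<bar> + \<bar>g m\<bar> * \<bar>e k\<bar>"
        unfolding e_def abs_mult distrib_left[symmetric]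
        by (intro mult_left_mono) auto
      ultimately show "\<bar>g m * (neg_binomial_coeff d (k - m) - rGamma d * real k powr (d - 1))\<bar>
          \<le> w m * h k"
        unfolding h_def distrib_left by linarith
    qed
    also have "\<dots> = (\<Sum>m\<le>k. w m) * h k" by (simp add: sum_distrib_right)
    also have "\<dots> \<le> suminf w * h k"
      using partial C(1) by (intro mult_right_mono) (auto simp: h_def)
    finally show ?thesis .
  qed
  have "h \<in> O(\<lambda>k. real k powr (d - 2))"
    unfolding h_def
  proof (rule sum_in_bigo)
    show "(\<lambda>k. C * real (Suc k) powr (d - 2)) \<in> O(\<lambda>k. real k powr (d - 2))" by real_asymp
    show "(\<lambda>k. \<bar>e k\<bar>) \<in> O(\<lambda>k. real k powr (d - 2))"
      using neg_binomial_coeff_asymp[of d] unfolding e_def by simp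
  qed
  then have "(\<lambda>k. suminf w * h k) \<in> O(\<lambda>k. real k powr (d - 2))"
    by simp
  moreover have "(\<lambda>k. \<Sum>m\<le>k. g m * (neg_binomial_coeff d (k - m) - rGamma d * real k powr (d - 1)))
      \<in> O(\<lambda>k. suminf w * h k)"
  proof (intro landau_o.big_mono always_eventually allI)
    fix k
    show "norm (\<Sum>m\<le>k. g m * (neg_binomial_coeff d (k - m) - rGamma d * real k powr (d - 1)))
      \<le> norm (suminf w * h k)"
      using bound[of k] unfolding real_norm_def by linarith
  qed
  ultimately show ?thesis by (rule landau_o.big_trans[rotated])
qed

text \<open>On the tail the weight \<open>j + 1\<close> exceeds \<open>n\<close>, so the tail is at most \<open>1/n\<close> times the weighted
  sum.\<close>

lemma suminf_tail_bigo:
  fixes f :: "nat \<Rightarrow> real"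
  assumes sm: "summable (\<lambda>j. \<bar>f j\<bar> * real (Suc j))"
  shows "(\<lambda>n. suminf f - (\<Sum>j\<le>n. f j)) \<in> O(\<lambda>n. 1 / real n)"
  \<comment> \<open>the summand 1 only makes the constant positive when \<open>f = 0\<close>\<close>
proof (rule landau_o.bigI[of "1 + (\<Sum>j. \<bar>f j\<bar> * real (Suc j))"])
  have abs: "summable (\<lambda>j. \<bar>f j\<bar>)"
  proof (rule summable_comparison_test'[OF sm])
    fix n
    show "norm \<bar>f n\<bar> \<le> \<bar>f n\<bar> * real (Suc n)" by (simp add: distrib_left)
  qed
  then have f: "summable f" by (rule summable_rabs_cancel)
  show "1 + (\<Sum>j. \<bar>f j\<bar> * real (Suc j)) > 0"
    using suminf_nonneg[OF sm] by simp
  show "eventually (\<lambda>n. norm (suminf f - (\<Sum>j\<le>n. f j))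
      \<le> (1 + (\<Sum>j. \<bar>f j\<bar> * real (Suc j))) * norm (1 / real n)) sequentially"
    using eventually_gt_at_top[of 0]
  proof eventually_elim
    case (elim n)
    have "suminf f - (\<Sum>j\<le>n. f j) = (\<Sum>j. f (j + Suc n))"
      using suminf_minus_initial_segment[OF f, of "Suc n"] by (simp add: lessThan_Suc_atMost)
    also have "\<bar>\<dots>\<bar> \<le> (\<Sum>j. \<bar>f (j + Suc n)\<bar>)"
      using summable_ignore_initial_segment[OF abs, of "Suc n"] by (rule summable_rabs)
    also have "\<dots> \<le> (\<Sum>j. 1 / real n * (\<bar>f (j + Suc n)\<bar> * real (Suc (j + Suc n))))"
    proof (rule suminf_le)
      fix j
      have "\<bar>f (j + Suc n)\<bar> * real n \<le> \<bar>f (j + Suc n)\<bar> * real (Suc (j + Suc n))"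
        by (intro mult_left_mono) auto
      then show "\<bar>f (j + Suc n)\<bar> \<le> 1 / real n * (\<bar>f (j + Suc n)\<bar> * real (Suc (j + Suc n)))"
        using elim by (simp add: field_simps)
    next
      show "summable (\<lambda>j. \<bar>f (j + Suc n)\<bar>)" using summable_ignore_initial_segment[OF abs, of "Suc n"] .
      show "summable (\<lambda>j. 1 / real n * (\<bar>f (j + Suc n)\<bar> * real (Suc (j + Suc n))))"
        using summable_ignore_initial_segment[OF sm, of "Suc n"] by (intro summable_mult)
    qed
    also have "\<dots> = 1 / real n * (\<Sum>j. \<bar>f (j + Suc n)\<bar> * real (Suc (j + Suc n)))"
      using summable_ignore_initial_segment[OF sm, of "Suc n"] by (intro suminf_mult)
    also have "(\<Sum>j. \<bar>f (j + Suc n)\<bar> * real (Suc (j + Suc n))) \<le> (\<Sum>j. \<bar>f j\<bar> * real (Suc j))"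
      using suminf_minus_initial_segment[OF sm, of "Suc n"]
      by (simp add: sum_nonneg del: sum.lessThan_Suc)
    finally have "\<bar>suminf f - (\<Sum>j\<le>n. f j)\<bar> \<le> 1 / real n * (\<Sum>j. \<bar>f j\<bar> * real (Suc j))"
      using elim by (simp add: divide_right_mono)
    also have "\<dots> \<le> 1 / real n * (1 + (\<Sum>j. \<bar>f j\<bar> * real (Suc j)))"
      by (intro mult_left_mono) auto
    finally show ?case by (simp add: mult.commute)
  qed
qed

section \<open>Power series of the lag polynomials\<close>

text \<open>Zeros of a nonconstant power series are isolated, so the difference of the two series, which
  vanishes on a disc, has only zero coefficients.\<close>

lemma power_series_coeff_unique:
  fixes u v :: "nat \<Rightarrow> complex"
  assumes "R > 0" "\<And>z. norm z < R \<Longrightarrow> (\<lambda>n. u n * z ^ n) sums F z"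
    and "\<And>z. norm z < R \<Longrightarrow> (\<lambda>n. v n * z ^ n) sums F z"
  shows "u n = v n"
proof (rule ccontr)
  assume neq: "u n \<noteq> v n"
  have sums0: "(\<lambda>n. (u n - v n) * (z - 0) ^ n) sums 0" if "norm (z - 0) < R" for z
    using sums_diff[OF assms(2)[of z] assms(3)[of z]] that by (simp add: left_diff_distrib)
  have "u 0 = v 0"
    using sums0[of 0] assms(1) by (simp add: powser_sums_zero_iff)
  with neq have n: "0 < n" by (cases n) auto
  show False
  proof (rule powser_0_nonzero[where a = "\<lambda>n. u n - v n" and f = "\<lambda>_. 0" and \<xi> = 0 and m = n])
    show "R > 0" by fact
    show "u n - v n \<noteq> 0" using neq by simp
    fix t :: real assume t: "0 < t" and nz: "\<And>z::complex. z \<in> cball 0 t - {0} \<Longrightarrow> (0::complex) \<noteq> 0"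
    show False using nz[of "of_real t"] t by simp
  qed (use sums0 n in auto)
qed


lemma power_series_abs_summable:
  fixes u :: "nat \<Rightarrow> complex"
  assumes "\<And>z. norm z < R \<Longrightarrow> (\<lambda>n. u n * z ^ n) sums F z" "norm z < R"
  shows "summable (\<lambda>n. norm (u n * z ^ n))"
proof -
  obtain x where x: "norm z < x" "x < R" using assms(2) dense by blast
  moreover from x have "x > 0" using norm_ge_zero[of z] by linarith
  ultimately have "norm (of_real x :: complex) = x" by simp
  then show ?thesis
    using assms(1)[of "of_real x"] x by (intro powser_insidea[of u "of_real x"]) (auto simp: sums_iff)
qed

lemma cpoly_of_real: "cpoly P (of_real x) = of_real (poly P x)"
  unfolding cpoly_def by (induction P) (auto simp: map_poly_pCons)

text \<open>The finitely many roots of \<open>B\<close> all lie outside the closed unit disc, so \<open>A/B\<close> is holomorphic on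
  a disc of radius \<open>R > 1\<close>. Its Taylor series there has the coefficients \<open>f\<close> by uniqueness;
  absolute convergence at a radius between \<open>1\<close> and \<open>R\<close> is geometric decay, and evaluation at
  \<open>1\<close> gives the sum.\<close>

lemma rational_power_series_decay:
  fixes f :: "nat \<Rightarrow> real"
  assumes nz: "\<And>z. norm z \<le> 1 \<Longrightarrow> cpoly B z \<noteq> 0"
    and ser: "\<And>z. norm z < 1 \<Longrightarrow> (\<lambda>k. complex_of_real (f k) * z ^ k) sums (cpoly A z / cpoly B z)"
  obtains \<rho> where "\<rho> > 1" "summable (\<lambda>n. \<bar>f n\<bar> * \<rho> ^ n)" "f sums (poly A 1 / poly B 1)"
proof -
  define Z where "Z = {z. cpoly B z = 0}"
  \<comment> \<open>inserting 2 covers a constant \<open>B\<close>, which has no roots\<close>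
  define R where "R = Min (insert 2 (norm ` Z))"
  have "map_poly complex_of_real B \<noteq> 0"
    using nz[of 0] by (auto simp: cpoly_def)
  then have fin: "finite Z" unfolding Z_def cpoly_def by (rule poly_roots_finite)
  have R: "R > 1"
    using fin nz unfolding R_def Z_def by (subst Min_gr_iff) (auto simp: not_le[symmetric])
  have nzR: "cpoly B z \<noteq> 0" if "norm z < R" for z
  proof
    assume "cpoly B z = 0"
    then have "R \<le> norm z" unfolding R_def using fin by (intro Min_le) (auto simp: Z_def)
    with that show False by simp
  qed
  define F where "F = (\<lambda>z. cpoly A z / cpoly B z)"
  have hol: "F holomorphic_on ball 0 R"
    using nzR unfolding F_def cpoly_def by (intro holomorphic_intros) auto
  define c where "c = (\<lambda>n. (deriv ^^ n) F 0 / fact n)"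
  have c: "(\<lambda>n. c n * z ^ n) sums F z" if "norm z < R" for z
    using holomorphic_power_series[OF hol, of z] that by (simp add: c_def)
  have fc: "c n = of_real (f n)" for n
    by (rule power_series_coeff_unique[of 1 c F]) (use c ser R in \<open>auto simp: F_def\<close>)
  have big: "(\<lambda>n. of_real (f n) * z ^ n) sums F z" if "norm z < R" for z
    using c[OF that] by (simp add: fc)
  define \<rho> where "\<rho> = (1 + R) / 2"
  have \<rho>: "\<rho> > 1" "\<rho> < R" using R by (auto simp: \<rho>_def)
  have "summable (\<lambda>n. norm (complex_of_real (f n) * of_real \<rho> ^ n))"
    using big \<rho> by (intro power_series_abs_summable) auto
  moreover have "norm (complex_of_real (f n) * of_real \<rho> ^ n) = \<bar>f n\<bar> * \<rho> ^ n" for n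
    using \<rho> by (simp add: norm_mult norm_power)
  ultimately have "summable (\<lambda>n. \<bar>f n\<bar> * \<rho> ^ n)" by simp
  moreover have "(\<lambda>n. complex_of_real (f n)) sums of_real (poly A 1 / poly B 1)"
    using big[of 1] R cpoly_of_real[of A 1] cpoly_of_real[of B 1] by (simp add: F_def)
  then have "f sums (poly A 1 / poly B 1)" by (simp only: sums_of_real_iff)
  ultimately show thesis using that \<rho> by blast
qed

lemma geometric_decay_imp_weighted_summable:
  fixes f :: "nat \<Rightarrow> real"
  assumes "\<rho> > 1" "summable (\<lambda>n. \<bar>f n\<bar> * \<rho> ^ n)"
  shows "summable (\<lambda>n. \<bar>f n\<bar> * real (Suc n) powr a)"
proof (rule summable_comparison_test_bigo)
  show "summable (\<lambda>n. norm (\<bar>f n\<bar> * \<rho> ^ n))"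
    using assms by (simp add: abs_mult)
  have "(\<lambda>n. real (Suc n) powr a) \<in> O(\<lambda>n. \<rho> ^ n)"
    using assms(1) by real_asymp
  then show "(\<lambda>n. \<bar>f n\<bar> * real (Suc n) powr a) \<in> O(\<lambda>n. \<bar>f n\<bar> * \<rho> ^ n)"
    by (intro landau_o.big.mult) auto
qed

lemma neg_binomial_series:
  fixes w :: complex
  assumes "norm w < 1"
  shows "(\<lambda>i. of_real (neg_binomial_coeff d i) * w ^ i) sums (1 - w) powr (- complex_of_real d)"
proof -
  have "((- complex_of_real d) gchoose i) * (- w) ^ i = of_real (neg_binomial_coeff d i) * w ^ i" for i
  proof -
    have "(-1) ^ i * (- w) ^ i = w ^ i" by (simp flip: power_mult_distrib)
    moreover have "((- complex_of_real d) gchoose i) = (-1) ^ i * of_real (neg_binomial_coeff d i)"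
      by (simp add: gbinomial_pochhammer neg_binomial_coeff_def pochhammer_of_real)
    ultimately show ?thesis by (simp add: mult_ac)
  qed
  then show ?thesis
    using gen_binomial_complex[of "- w" "- complex_of_real d"] assms by simp
qed

text \<open>The series of \<open>(1 - z\<^sup>s)\<^sup>-\<^sup>d\<close> is the negative binomial series spread out over the multiples of
  \<open>s\<close>. Its Cauchy product with the series of \<open>F\<close> must agree with \<open>lam\<close> by uniqueness of
  coefficients.\<close>

lemma seasonal_series_coeff:
  fixes f lam :: "nat \<Rightarrow> real" and F :: "complex \<Rightarrow> complex"
  assumes s: "s \<ge> 1"
    and f: "\<And>z. norm z < 1 \<Longrightarrow> (\<lambda>k. complex_of_real (f k) * z ^ k) sums F z"
    and lam: "\<And>z. norm z < 1 \<Longrightarrow> (\<lambda>k. complex_of_real (lam k) * z ^ k) sums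
           (F z * (1 - z ^ s) powr (- complex_of_real d))"
  shows "lam n = (\<Sum>j\<le>n. f j * (if s dvd n - j then neg_binomial_coeff d ((n - j) div s) else 0))"
proof -
  define C where "C = (\<lambda>n. if s dvd n then neg_binomial_coeff d (n div s) else 0)"
  have C: "(\<lambda>n. complex_of_real (C n) * z ^ n) sums (1 - z ^ s) powr (- complex_of_real d)"
    if "norm z < 1" for z
  proof -
    have "norm (z ^ s) < 1"
      using that s power_Suc_less_one[of "norm z" "s - 1"] by (auto simp: norm_power power_less_one_iff)
    then have "(\<lambda>i. of_real (neg_binomial_coeff d i) * (z ^ s) ^ i)
        sums (1 - z ^ s) powr (- complex_of_real d)"
      by (rule neg_binomial_series)
    then have "(\<lambda>i. complex_of_real (C (s * i)) * z ^ (s * i))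
        sums (1 - z ^ s) powr (- complex_of_real d)"
      using s by (simp add: C_def power_mult)
    moreover have "strict_mono (\<lambda>i. s * i)" using s by (auto simp: strict_mono_def)
    ultimately show ?thesis
      by (subst (asm) sums_mono_reindex) (auto simp: C_def elim!: dvdE)
  qed
  define u where "u = (\<lambda>n. \<Sum>j\<le>n. f j * C (n - j))"
  have "(\<lambda>n. complex_of_real (u n) * z ^ n) sums (F z * (1 - z ^ s) powr (- complex_of_real d))"
    if z: "norm z < 1" for z
  proof -
    have "(\<lambda>n. \<Sum>j\<le>n. (complex_of_real (f j) * z ^ j) * (complex_of_real (C (n - j)) * z ^ (n - j)))
      sums ((\<Sum>n. complex_of_real (f n) * z ^ n) * (\<Sum>n. complex_of_real (C n) * z ^ n))"
      by (intro Cauchy_product_sums power_series_abs_summable[OF f z]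
          power_series_abs_summable[OF C z])
    moreover have "(\<Sum>j\<le>n. (complex_of_real (f j) * z ^ j) * (complex_of_real (C (n - j)) * z ^ (n - j)))
      = complex_of_real (u n) * z ^ n" for n
      unfolding u_def of_real_sum sum_distrib_right
    proof (rule sum.cong[OF refl])
      fix j assume "j \<in> {..n}"
      then have "z ^ j * z ^ (n - j) = z ^ n" by (simp flip: power_add)
      then show "(complex_of_real (f j) * z ^ j) * (complex_of_real (C (n - j)) * z ^ (n - j))
        = complex_of_real (f j * C (n - j)) * z ^ n"
        by (simp add: mult_ac)
    qed
    ultimately show ?thesis
      using sums_unique[OF f[OF z]] sums_unique[OF C[OF z]] by simp
  qed
  then have "complex_of_real (lam n) = of_real (u n)"
    using lam by (intro power_series_coeff_unique[of 1 "\<lambda>n. of_real (lam n)"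
        "\<lambda>z. F z * (1 - z ^ s) powr (- complex_of_real d)" "\<lambda>n. of_real (u n)"]) auto
  then show ?thesis by (simp only: of_real_eq_iff u_def C_def)
qed

section \<open>The coefficients along a residue class\<close>

text \<open>The indicator in the theorem thus selects the indices outside the residue class of \<open>r\<close>. For
  \<open>j < r\<close> the distance is smaller than \<open>s\<close> and positive, so the quotient is not an integer.\<close>

lemma scaled_distance_in_Nats_iff:
  assumes "r < s"
  shows "\<bar>real j - real r\<bar> / real s \<in> \<nat> \<longleftrightarrow> j mod s = r"
proof
  assume "\<bar>real j - real r\<bar> / real s \<in> \<nat>"
  then obtain n where "\<bar>real j - real r\<bar> / real s = real n" by (auto elim: Nats_cases)
  then have eq: "\<bar>real j - real r\<bar> = real (n * s)" using assms by (simp add: field_simps)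
  show "j mod s = r"
  proof (cases "j \<ge> r")
    case True
    with eq have "real j = real (r + n * s)" by simp
    then show ?thesis using assms by (simp only: of_nat_eq_iff) simp
  next
    case False
    with eq have "real r = real (j + n * s)" by simp
    then have "r = j + n * s" by (simp only: of_nat_eq_iff)
    with assms False show ?thesis by (cases n) auto
  qed
next
  assume "j mod s = r"
  then have "j = s * (j div s) + r" by (metis mult_div_mod_eq)
  then have "real j = real s * real (j div s) + real r" by (metis of_nat_add of_nat_mult)
  then have "\<bar>real j - real r\<bar> / real s = real (j div s)" using assms by simp
  then show "\<bar>real j - real r\<bar> / real s \<in> \<nat>" by simp
qed

lemma sum_residue_class:
  fixes h :: "nat \<Rightarrow> 'a :: comm_monoid_add"
  assumes "r < s"
  shows "(\<Sum>j\<le>s * k + r. if j mod s = r then h j else 0) = (\<Sum>m\<le>k. h (s * m + r))"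
proof -
  have "(\<Sum>j\<le>s * k + r. if j mod s = r then h j else 0) = (\<Sum>j | j \<le> s * k + r \<and> j mod s = r. h j)"
    by (simp add: sum.If_cases Int_def)
  also have "\<dots> = (\<Sum>m\<le>k. h (s * m + r))"
  proof (rule sum.reindex_bij_witness[of _ "\<lambda>m. s * m + r" "\<lambda>j. j div s"])
    fix j assume j: "j \<in> {j. j \<le> s * k + r \<and> j mod s = r}"
    then show eq: "s * (j div s) + r = j" by (metis (mono_tags) mem_Collect_eq mult_div_mod_eq)
    have "(j div s) \<le> (s * k + r) div s" using j by (intro div_le_mono) auto
    then show "j div s \<in> {..k}" using assms by simp
    show "h (s * (j div s) + r) = h j" using eq by simp
  qed (use assms in auto)
  finally show ?thesis .
qed

text \<open>Along the residue class of \<open>r\<close> the coefficient is a plain convolution of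
  \<open>g\<^sub>m = f\<^bsub>s m + r\<^esub>\<close> with the negative binomial coefficients. Splitting the partial sum of \<open>f\<close>
  into this class and the others turns the deviation from the claimed main term into the
  convolution error minus \<open>k\<^bsup>d-1\<^esup> / \<Gamma>(d)\<close> times the tail of \<open>\<Sum>j. f\<^sub>j\<close>.\<close>

lemma seasonal_coeff_asymp:
  fixes f lam :: "nat \<Rightarrow> real"
  assumes s: "s \<ge> 1" and r: "r < s" and d: "d < 2"
    and lam: "\<And>n. lam n
      = (\<Sum>j\<le>n. f j * (if s dvd n - j then neg_binomial_coeff d ((n - j) div s) else 0))"
    and f: "\<And>a. summable (\<lambda>j. \<bar>f j\<bar> * real (Suc j) powr a)"
  shows "(\<lambda>k. lam (s * k + r) - rGamma d * real k powr (d - 1) *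
      (suminf f - (\<Sum>j\<le>s * k + r. f j * indicator (UNIV - \<nat>) (\<bar>real j - real r\<bar> / real s))))
    \<in> O(\<lambda>k. real k powr (d - 2))"
proof -
  define g where "g = (\<lambda>m. f (s * m + r))"
  have lam': "lam (s * k + r) = (\<Sum>m\<le>k. g m * neg_binomial_coeff d (k - m))" for k
  proof -
    have "lam (s * k + r) = (\<Sum>j\<le>s * k + r.
        if j mod s = r then f j * neg_binomial_coeff d ((s * k + r - j) div s) else 0)"
      unfolding lam
    proof (rule sum.cong[OF refl])
      fix j assume "j \<in> {..s * k + r}"
      then have "s dvd (s * k + r) - j \<longleftrightarrow> (s * k + r) mod s = j mod s"
        by (intro mod_eq_dvd_iff_nat[symmetric]) auto
      then have "s dvd (s * k + r) - j \<longleftrightarrow> j mod s = r" using r by auto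
      then show "f j * (if s dvd s * k + r - j then neg_binomial_coeff d ((s * k + r - j) div s) else 0)
        = (if j mod s = r then f j * neg_binomial_coeff d ((s * k + r - j) div s) else 0)"
        by simp
    qed
    also have "\<dots> = (\<Sum>m\<le>k. f (s * m + r) * neg_binomial_coeff d ((s * k + r - (s * m + r)) div s))"
      by (rule sum_residue_class[OF r])
    also have "\<dots> = (\<Sum>m\<le>k. g m * neg_binomial_coeff d (k - m))"
      using s by (simp add: g_def flip: diff_mult_distrib2)
    finally show ?thesis .
  qed
  have ind: "(\<Sum>j\<le>s * k + r. f j * indicator (UNIV - \<nat>) (\<bar>real j - real r\<bar> / real s))
      = (\<Sum>j\<le>s * k + r. f j) - (\<Sum>m\<le>k. g m)" for k
  proof -
    have "(\<Sum>j\<le>s * k + r. f j * indicator (UNIV - \<nat>) (\<bar>real j - real r\<bar> / real s))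
      = (\<Sum>j\<le>s * k + r. f j - (if j mod s = r then f j else 0))"
      by (intro sum.cong refl) (auto simp: indicator_def scaled_distance_in_Nats_iff[OF r])
    then show ?thesis by (simp add: sum_subtractf sum_residue_class[OF r] g_def)
  qed
  have "summable (\<lambda>m. \<bar>g m\<bar> * real (Suc m) powr (3 - d))"
  proof (rule summable_comparison_test')
    have "inj (\<lambda>m. s * m + r)" using s by (auto intro!: injI)
    then show "summable ((\<lambda>j. \<bar>f j\<bar> * real (Suc j) powr (3 - d)) \<circ> (\<lambda>m. s * m + r))"
      using f by (intro summable_reindex) auto
    fix m :: nat
    have "m \<le> s * m + r" using s by (cases s) auto
    then have "real (Suc m) \<le> real (Suc (s * m + r))" by (simp only: of_nat_le_iff Suc_le_mono)
    then have "real (Suc m) powr (3 - d) \<le> real (Suc (s * m + r)) powr (3 - d)"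
      using d by (intro powr_mono2) auto
    then show "norm (\<bar>g m\<bar> * real (Suc m) powr (3 - d))
        \<le> ((\<lambda>j. \<bar>f j\<bar> * real (Suc j) powr (3 - d)) \<circ> (\<lambda>m. s * m + r)) m"
      by (simp add: g_def abs_mult mult_left_mono)
  qed
  then have main: "(\<lambda>k. \<Sum>m\<le>k. g m * (neg_binomial_coeff d (k - m) - rGamma d * real k powr (d - 1)))
      \<in> O(\<lambda>k. real k powr (d - 2))"
    by (rule convolution_neg_binomial_asymp[OF d])
  define t where "t = (\<lambda>k. suminf f - (\<Sum>j\<le>s * k + r. f j))"
  have "(\<lambda>n. suminf f - (\<Sum>j\<le>n. f j)) \<in> O(\<lambda>n. 1 / real n)"
    using f[of 1] by (intro suminf_tail_bigo) simp
  moreover have "filterlim (\<lambda>k. s * k + r) at_top sequentially"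
    using s by (intro filterlim_subseq) (auto simp: strict_mono_def)
  ultimately have "t \<in> O(\<lambda>k. 1 / real (s * k + r))"
    unfolding t_def by (rule landau_o.big.compose)
  also have "(\<lambda>k. 1 / real (s * k + r)) \<in> O(\<lambda>k. 1 / real k)"
    using s by (simp; real_asymp)
  finally have "(\<lambda>k. rGamma d * real k powr (d - 1) * t k)
      \<in> O(\<lambda>k. real k powr (d - 1) * (1 / real k))"
    by (intro landau_o.big.mult) auto
  also have "(\<lambda>k. real k powr (d - 1) * (1 / real k)) \<in> O(\<lambda>k. real k powr (d - 2))"
    by real_asymp
  finally have "(\<lambda>k. (\<Sum>m\<le>k. g m * (neg_binomial_coeff d (k - m) - rGamma d * real k powr (d - 1)))
      - rGamma d * real k powr (d - 1) * t k) \<in> O(\<lambda>k. real k powr (d - 2))"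
    using main by (intro sum_in_bigo)
  moreover have "lam (s * k + r) - rGamma d * real k powr (d - 1) *
      (suminf f - (\<Sum>j\<le>s * k + r. f j * indicator (UNIV - \<nat>) (\<bar>real j - real r\<bar> / real s)))
    = (\<Sum>m\<le>k. g m * (neg_binomial_coeff d (k - m) - rGamma d * real k powr (d - 1)))
      - rGamma d * real k powr (d - 1) * t k" for k
    unfolding lam' ind t_def right_diff_distrib sum_subtractf
    by (simp add: algebra_simps flip: sum_distrib_left sum_distrib_right)
  ultimately show ?thesis by simp
qed

theorem theorem1p2:
  fixes d :: real and s r p q :: nat
    and a b :: "nat \<Rightarrow> real" and \<alpha> \<beta> :: "real poly"
    and lam f :: "nat \<Rightarrow> real"
  assumes "s \<ge> 1" and "r < s" and "d < 1 / 2"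
    and "\<alpha> = lag_poly a p" and "\<beta> = lag_poly b q"
    and "a 0 = -1" and "b 0 = -1"
    and "\<And>z. \<not> (cpoly \<alpha> z = 0 \<and> cpoly \<beta> z = 0)"
    and "\<And>z. norm z \<le> 1 \<Longrightarrow> cpoly \<beta> z \<noteq> 0"
    and "\<And>z. norm z < 1 \<Longrightarrow> (\<lambda>k. complex_of_real (lam k) * z ^ k) sums
           (cpoly \<alpha> z / cpoly \<beta> z * (1 - z ^ s) powr (- complex_of_real d))"
    and "\<And>z. norm z < 1 \<Longrightarrow> (\<lambda>k. complex_of_real (f k) * z ^ k) sums
           (cpoly \<alpha> z / cpoly \<beta> z)"
  defines "T1 \<equiv> \<lambda>k::nat. rGamma d / real k powr (1 - d) * (poly \<alpha> 1 / poly \<beta> 1)"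
    and "T2 \<equiv> \<lambda>k::nat. rGamma d / real k powr (1 - d) *
           (\<Sum>j = 0..s * k + r. f j * indicator (UNIV - \<nat>) (\<bar>real j - real r\<bar> / real s))"
  shows "(\<lambda>k. lam (s * k + r) - (T1 k - T2 k)) \<in> O(\<lambda>k. real k powr (d - 2)) \<and>
    (\<exists>u \<in> O(\<lambda>k. real k powr (d - 1)). \<exists>v \<in> O(\<lambda>k. real k powr (d - 1)).
     \<exists>w \<in> O(\<lambda>k. real k powr (d - 2)).
       \<forall>k. lam (s * k + r) = u k + v k * indicator (UNIV - {0, 1}) s + w k \<and>
           u k = T1 k \<and> v k * indicator (UNIV - {0, 1}) s = - T2 k)"
proof (rule conjI)
  obtain \<rho> where \<rho>: "\<rho> > 1" "summable (\<lambda>n. \<bar>f n\<bar> * \<rho> ^ n)" "f sums (poly \<alpha> 1 / poly \<beta> 1)"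
    using rational_power_series_decay[OF assms(9,11)] by metis
  have weighted: "summable (\<lambda>j. \<bar>f j\<bar> * real (Suc j) powr a)" for a
    using \<rho>(1,2) by (rule geometric_decay_imp_weighted_summable)
  define S where "S = (\<lambda>k. \<Sum>j = 0..s * k + r. f j * indicator (UNIV - \<nat>) (\<bar>real j - real r\<bar> / real s))"
  have T1: "T1 k = rGamma d * real k powr (d - 1) * (poly \<alpha> 1 / poly \<beta> 1)" for k
    using powr_minus_divide[of "real k" "1 - d"] by (simp add: T1_def)
  have T2: "T2 k = rGamma d * real k powr (d - 1) * S k" for k
    using powr_minus_divide[of "real k" "1 - d"] by (simp add: T2_def S_def)
  have "(\<lambda>k. lam (s * k + r) - rGamma d * real k powr (d - 1) * (suminf f - S k))
      \<in> O(\<lambda>k. real k powr (d - 2))"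
    unfolding S_def atLeast0AtMost
    using assms(1-3) seasonal_series_coeff[OF assms(1,11,10)] weighted
    by (intro seasonal_coeff_asymp) auto
  then show first: "(\<lambda>k. lam (s * k + r) - (T1 k - T2 k)) \<in> O(\<lambda>k. real k powr (d - 2))"
    using sums_unique[OF \<rho>(3)] by (simp add: T1 T2 right_diff_distrib)
  have "T1 \<in> O(\<lambda>k. real k powr (d - 1))"
  proof -
    have "(\<lambda>k. (rGamma d * (poly \<alpha> 1 / poly \<beta> 1)) * real k powr (d - 1))
        \<in> O(\<lambda>k. real k powr (d - 1))"
      by (intro bigoI[where c = "\<bar>rGamma d * (poly \<alpha> 1 / poly \<beta> 1)\<bar>"]) (auto simp: abs_mult)
    then show ?thesis by (simp add: T1[abs_def] mult_ac)
  qed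
  moreover have "(\<lambda>k. - T2 k) \<in> O(\<lambda>k. real k powr (d - 1))"
  proof -
    have abs: "summable (\<lambda>j. \<bar>f j\<bar>)" using weighted[of 0] by simp
    have "\<bar>S k\<bar> \<le> (\<Sum>j. \<bar>f j\<bar>)" for k
    proof -
      have "\<bar>S k\<bar> \<le> (\<Sum>j = 0..s * k + r. \<bar>f j\<bar>)"
        unfolding S_def by (rule order.trans[OF sum_abs sum_mono]) (auto simp: indicator_def)
      also have "\<dots> \<le> (\<Sum>j. \<bar>f j\<bar>)" using abs by (intro sum_le_suminf) auto
      finally show ?thesis .
    qed
    then have "S \<in> O(\<lambda>_. 1)"
      by (intro bigoI[of _ "\<Sum>j. \<bar>f j\<bar>"]) auto
    then have "(\<lambda>k. rGamma d * real k powr (d - 1) * S k) \<in> O(\<lambda>k. real k powr (d - 1) * 1)"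
      by (intro landau_o.big.mult) auto
    then show ?thesis by (simp add: T2)
  qed
  \<comment> \<open>for \<open>s = 1\<close> there is only one residue class, and every indicator vanishes\<close>
  moreover have "- T2 k * indicator (UNIV - {0, 1}) s = - T2 k" for k
  proof (cases "s = 1")
    case True
    then have "S k = 0"
      unfolding S_def using scaled_distance_in_Nats_iff[OF assms(2)] assms(2)
      by (intro sum.neutral) (auto simp: indicator_def)
    then show ?thesis by (simp add: T2)
  qed (use assms(1) in auto)
  ultimately show "\<exists>u \<in> O(\<lambda>k. real k powr (d - 1)). \<exists>v \<in> O(\<lambda>k. real k powr (d - 1)).
     \<exists>w \<in> O(\<lambda>k. real k powr (d - 2)).
       \<forall>k. lam (s * k + r) = u k + v k * indicator (UNIV - {0, 1}) s + w k \<and>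
           u k = T1 k \<and> v k * indicator (UNIV - {0, 1}) s = - T2 k"
    using first
    by (intro bexI[of _ T1] bexI[of _ "\<lambda>k. - T2 k"]
          bexI[of _ "\<lambda>k. lam (s * k + r) - (T1 k - T2 k)"]) auto
qed

end
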